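(* Let $\mathcal{A}\in\mathbb{R}^{[m,n]}$ be a nonsingular $M$-tensor and $b\in\mathbb{R}^n$ with $b\ge 0$. Suppose that, for $k=1,2,\ldots$, $x^{(k)}$ is the unique positive solution of $\mathcal{A}x^{m-1}=b^{(k)}$, where $b^{(k)}>0$ and $b^{(k)}$ is monotonically decreasing (entrywise) and converges to $b$ as $k\to\infty$. Then, as $k\to\infty$, $x^{(k)}$ converges to the maximal nonnegative solution $x_{\max}(\mathcal{A},b)$ of $\mathcal{A}x^{m-1}=b$.
   Context: $\mathbb{R}^{[m,n]}$ ($m\ge 2$, $n\ge 1$) is the set of real $m$th-order $n$-dimensional tensors $\mathcal{A}=(a_{i_1i_2\ldots i_m})$, $1\le i_1,\ldots,i_m\le n$. For $x\in\mathbb{R}^n$, $\mathcal{A}x^{m-1}\in\mathbb{R}^n$ has entries $(\mathcal{A}x^{m-1})_i=\sum_{i_2,\ldots,i_m=1}^n a_{ii_2\ldots i_m}x_{i_2}\cdots x_{i_m}$. Inequalities for vectors and tensors are entrywise; a vector $x$ is positive if $x>0$. $(x^{[r]})_i=(x_i)^r$. The identity tensor $\mathcal{I}$ has diagonal elements $\mathcal{I}_{ii\ldots i}=1$ and all other elements $0$. A real $\lambda$ is an eigenvalue of $\mathcal{B}$ if $\mathcal{B}x^{m-1}=\lambda x^{[m-1]}$ for some $x\in\mathbb{R}^n\setminus\{0\}$; the spectral radius $\rho(\mathcal{B})$ is the maximum modulus of the eigenvalues. $\mathcal{A}$ is a nonsingular $M$-tensor if $\mathcal{A}=s\mathcal{I}-\mathcal{B}$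 with $\mathcal{B}\ge 0$ and $s>\rho(\mathcal{B})$. For such $\mathcal{A}$ and a positive right side vector, the equation has a unique positive solution. A maximal nonnegative solution is a nonnegative solution $x$ with $x\ge y$ for every solution $y\ge 0$; it exists for a nonsingular $M$-tensor $\mathcal{A}$ and $b\ge 0$. *)

theory Defs
  imports "HOL-Analysis.Analysis"
begin

text \<open>
  An order-m tensor over the index type 'n (so the dimension is CARD('n)) is a function on
  index lists. Only its values on lists of length m are meaningful; every notion below that
  takes the order m as an argument inspects those values only.
\<close>

type_synonym 'n tensor = "'n list \<Rightarrow> real"

definition tensor_apply :: "nat \<Rightarrow> 'n::finite tensor \<Rightarrow> real ^ 'n \<Rightarrow> real ^ 'n" where
  "tensor_apply m A x =
     (\<chi> i. \<Sum>js\<in>{js. length js = m - 1}. A (i # js) * prod_list (map (\<lambda>j. x $ j) js))"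

definition vec_pow :: "real ^ 'n \<Rightarrow> nat \<Rightarrow> real ^ 'n" where
  "vec_pow x r = (\<chi> i. (x $ i) ^ r)"

definition identity_tensor :: "'n tensor" where
  "identity_tensor idx = (if \<exists>i. idx = replicate (length idx) i then 1 else 0)"

definition nonneg_tensor :: "nat \<Rightarrow> 'n tensor \<Rightarrow> bool" where
  "nonneg_tensor m A \<longleftrightarrow> (\<forall>idx. length idx = m \<longrightarrow> 0 \<le> A idx)"

text \<open>
  The library order on vectors is entrywise, but its strict part is not: there, x < y only
  means x \<le> y and x \<noteq> y. Hence a separate predicate for entrywise positivity.
\<close>

definition positive_vec :: "real ^ 'n \<Rightarrow> bool" where
  "positive_vec x \<longleftrightarrow> (\<forall>i. 0 < x $ i)"

text \<open>Eigenvalues are real and have real eigenvectors.\<close>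

definition tensor_eigenvalue :: "nat \<Rightarrow> 'n::finite tensor \<Rightarrow> real \<Rightarrow> bool" where
  "tensor_eigenvalue m B l \<longleftrightarrow>
     (\<exists>x. x \<noteq> 0 \<and> tensor_apply m B x = l *\<^sub>R vec_pow x (m - 1))"

text \<open>
  The maximum exists whenever B is nonnegative (Perron-Frobenius), the only case in which
  the spectral radius is used here; it is unspecified if there are no eigenvalues.
\<close>

definition tensor_spectral_radius :: "nat \<Rightarrow> 'n::finite tensor \<Rightarrow> real" where
  "tensor_spectral_radius m B = (GREATEST r. \<exists>l. tensor_eigenvalue m B l \<and> r = \<bar>l\<bar>)"

definition nonsingular_M_tensor :: "nat \<Rightarrow> 'n::finite tensor \<Rightarrow> bool" where
  "nonsingular_M_tensor m A \<longleftrightarrow>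
     (\<exists>s B. nonneg_tensor m B \<and> tensor_spectral_radius m B < s \<and>
        (\<forall>idx. length idx = m \<longrightarrow> A idx = s * identity_tensor idx - B idx))"

definition unique_positive_solution ::
    "nat \<Rightarrow> 'n::finite tensor \<Rightarrow> real ^ 'n \<Rightarrow> real ^ 'n \<Rightarrow> bool" where
  "unique_positive_solution m A b x \<longleftrightarrow>
     positive_vec x \<and> tensor_apply m A x = b \<and>
     (\<forall>y. positive_vec y \<and> tensor_apply m A y = b \<longrightarrow> y = x)"

definition maximal_nonneg_solution ::
    "nat \<Rightarrow> 'n::finite tensor \<Rightarrow> real ^ 'n \<Rightarrow> real ^ 'n \<Rightarrow> bool" where
  "maximal_nonneg_solution m A b x \<longleftrightarrow>
     0 \<le> x \<and> tensor_apply m A x = b \<and>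
     (\<forall>y. 0 \<le> y \<and> tensor_apply m A y = b \<longrightarrow> y \<le> x)"

definition x_max :: "nat \<Rightarrow> 'n::finite tensor \<Rightarrow> real ^ 'n \<Rightarrow> real ^ 'n" where
  "x_max m A b = (THE x. maximal_nonneg_solution m A b x)"

lemma maximal_nonneg_solution_unique:
  assumes "maximal_nonneg_solution m A b x" and "maximal_nonneg_solution m A b y"
  shows "x = y"
  using assms unfolding maximal_nonneg_solution_def by (blast intro: antisym)

lemma x_max_eq: "maximal_nonneg_solution m A b x \<Longrightarrow> x_max m A b = x"
  unfolding x_max_def by (blast intro: the_equality maximal_nonneg_solution_unique)

end

theory Submission
  imports Defs
begin

text \<open>
  The only property of a nonsingular M-tensor that is needed is its shape $s I - B$ with
  $B \ge 0$. It yields a comparison principle: if $x > 0$, $y \ge 0$ and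
  $A y^{m-1} \le A x^{m-1}$ with $A x^{m-1} > 0$, then $y \le x$. Otherwise take $i$ maximizing
  $t = y_i / x_i > 1$; then $y \le t x$ with equality at $i$, so
  $(A y^{m-1})_i \ge t^{m-1} (A x^{m-1})_i > (A x^{m-1})_i$. Hence the $x^{(k)}$ decrease and
  dominate every nonnegative solution for $b$, and their limit solves the equation by continuity.
\<close>

lemma finite_length_eq: "finite {js :: 'n::finite list. length js = k}"
  using finite_lists_length_eq[of "UNIV :: 'n set" k] by simp

lemma tensor_apply_nth:
  "tensor_apply m A x $ i =
     (\<Sum>js\<in>{js. length js = m - 1}. A (i # js) * prod_list (map (\<lambda>j. x $ j) js))"
  by (simp add: tensor_apply_def)

text \<open>The head forces the witness in \<open>identity_tensor\<close> to be \<open>i\<close>, so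
  the diagonal test becomes equality with a single list and a sum over all index lists can collapse
  to one term.\<close>

lemma identity_tensor_Cons:
  assumes "length js = k"
  shows "identity_tensor (i # js) = (if js = replicate k i then 1 else 0)"
  using assms by (auto simp: identity_tensor_def)

lemma tensor_apply_identity:
  assumes "2 \<le> m"
  shows "tensor_apply m identity_tensor x = vec_pow x (m - 1)"
proof (rule vec_eq_iff[THEN iffD2], rule allI)
  fix i
  have "tensor_apply m identity_tensor x $ i =
      (\<Sum>js\<in>{js. length js = m - 1}.
        if js = replicate (m - 1) i then prod_list (map (\<lambda>j. x $ j) js) else 0)"
    unfolding tensor_apply_nth by (rule sum.cong) (auto simp: identity_tensor_Cons)
  also have "\<dots> = prod_list (map (\<lambda>j. x $ j) (replicate (m - 1) i))"
    by (simp add: sum.delta finite_length_eq)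
  also have "\<dots> = vec_pow x (m - 1) $ i"
    by (simp add: vec_pow_def)
  finally show "tensor_apply m identity_tensor x $ i = vec_pow x (m - 1) $ i" .
qed

lemma tensor_apply_shifted_identity:
  assumes "2 \<le> m"
    and A: "\<And>idx. length idx = m \<Longrightarrow> A idx = s * identity_tensor idx - B idx"
  shows "tensor_apply m A x $ i = s * (x $ i) ^ (m - 1) - tensor_apply m B x $ i"
proof -
  \<comment> \<open>Linearity in the tensor. The decomposition of \<open>A\<close> is known only on
    lists of length m; \<open>i # js\<close> has that length because m > 0, so that the truncated m
    - 1 is a true predecessor.\<close>
  have "tensor_apply m A x $ i = s * tensor_apply m identity_tensor x $ i - tensor_apply m B x $ i"
    unfolding tensor_apply_nth sum_distrib_left sum_subtractf[symmetric]
    using \<open>2 \<le> m\<close> by (intro sum.cong) (auto simp: A algebra_simps)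
  then show ?thesis
    using \<open>2 \<le> m\<close> by (simp add: tensor_apply_identity vec_pow_def)
qed

text \<open>Nonnegativity is carried through the induction because multiplying two inequalities
  needs it. The signs of \<open>t\<close> and \<open>g\<close> are not assumed:
  \<open>0 \<le> t * g j\<close> follows from \<open>f\<close>.\<close>

lemma prod_list_map_le_scaled:
  fixes f g :: "'a \<Rightarrow> real"
  assumes "\<And>j. 0 \<le> f j" and "\<And>j. f j \<le> t * g j"
  shows "0 \<le> prod_list (map f js) \<and>
    prod_list (map f js) \<le> t ^ length js * prod_list (map g js)"
proof (induction js)
  case (Cons j js)
  have "f j * prod_list (map f js) \<le> (t * g j) * (t ^ length js * prod_list (map g js))"
    using Cons assms by (intro mult_mono) (auto intro: order_trans)
  then show ?case
    using Cons assms by (simp add: ac_simps)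
qed simp

text \<open>Monotonicity and homogeneity at once: each monomial has m - 1 factors, and the entries
  of \<open>B\<close> are nonnegative weights.\<close>

lemma tensor_apply_le_scaled:
  assumes "1 \<le> m" and "nonneg_tensor m B"
    and "\<And>j. 0 \<le> y $ j" and "\<And>j. y $ j \<le> t * x $ j"
  shows "tensor_apply m B y $ i \<le> t ^ (m - 1) * tensor_apply m B x $ i"
proof -
  have "B (i # js) * prod_list (map (\<lambda>j. y $ j) js)
      \<le> t ^ (m - 1) * (B (i # js) * prod_list (map (\<lambda>j. x $ j) js))"
    if "length js = m - 1" for js
  proof -
    have "0 \<le> B (i # js)"
      using assms(1,2) that by (simp add: nonneg_tensor_def)
    moreover have "prod_list (map (\<lambda>j. y $ j) js) \<le> t ^ (m - 1) * prod_list (map (\<lambda>j. x $ j) js)"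
      using prod_list_map_le_scaled[of "\<lambda>j. y $ j" t "\<lambda>j. x $ j" js] assms(3,4) that by simp
    ultimately show ?thesis
      using mult_left_mono by (fastforce simp: mult.left_commute)
  qed
  then show ?thesis
    unfolding tensor_apply_nth sum_distrib_left by (intro sum_mono) auto
qed

lemma nonsingular_M_tensor_comparison:
  assumes "2 \<le> m" and "nonsingular_M_tensor m A"
    and x: "positive_vec x" and Ax: "positive_vec (tensor_apply m A x)"
    and y: "0 \<le> y" and le: "tensor_apply m A y \<le> tensor_apply m A x"
  shows "y \<le> x"
proof (rule ccontr)
  assume "\<not> y \<le> x"
  then obtain i0 where i0: "x $ i0 < y $ i0"
    by (auto simp: less_eq_vec_def not_le)
  obtain s B where B: "nonneg_tensor m B"
    and A: "\<And>idx. length idx = m \<Longrightarrow> A idx = s * identity_tensor idx - B idx"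
    using assms(2) by (auto simp: nonsingular_M_tensor_def)
  have xpos: "0 < x $ j" for j
    using x by (simp add: positive_vec_def)
  have shape: "tensor_apply m A z $ i = s * (z $ i) ^ (m - 1) - tensor_apply m B z $ i" for z i
    using \<open>2 \<le> m\<close> A by (rule tensor_apply_shifted_identity)
  define t where "t = Max (range (\<lambda>j. y $ j / x $ j))"
  have ge: "y $ j / x $ j \<le> t" for j
    unfolding t_def by (rule Max_ge) auto
  have "t \<in> range (\<lambda>j. y $ j / x $ j)"
    unfolding t_def by (rule Max_in) auto
  then obtain i where "t = y $ i / x $ i" by auto
  then have yi: "y $ i = t * x $ i"
    using xpos[of i] by simp
  have ytx: "y $ j \<le> t * x $ j" for j
    using ge[of j] xpos[of j] by (simp add: field_simps)
  have "1 < y $ i0 / x $ i0"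
    using i0 xpos[of i0] by simp
  then have "1 < t"
    using ge[of i0] by linarith
  then have "1 < t ^ (m - 1)"
    using \<open>2 \<le> m\<close> by (intro one_less_power) auto
  moreover have pos: "0 < tensor_apply m A x $ i"
    using Ax by (simp add: positive_vec_def)
  ultimately have "tensor_apply m A x $ i < t ^ (m - 1) * tensor_apply m A x $ i"
    by simp
  also have "\<dots> = s * (t * x $ i) ^ (m - 1) - t ^ (m - 1) * tensor_apply m B x $ i"
    unfolding shape[of x] by (simp add: right_diff_distrib power_mult_distrib)
  \<comment> \<open>The diagonal terms agree exactly, since \<open>y $ i = t * x $ i\<close>, so the
    sign of \<open>s\<close> is irrelevant; only the \<open>B\<close> term is estimated.\<close>
  also have "\<dots> \<le> s * (y $ i) ^ (m - 1) - tensor_apply m B y $ i"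
    using tensor_apply_le_scaled[OF _ B _ ytx, of i] \<open>2 \<le> m\<close> y
    by (simp add: yi less_eq_vec_def)
  also have "\<dots> = tensor_apply m A y $ i"
    by (simp only: shape)
  also have "\<dots> \<le> tensor_apply m A x $ i"
    using le by (simp add: less_eq_vec_def)
  finally show False by simp
qed

lemma tendsto_prod_list_map:
  fixes f :: "'a \<Rightarrow> 'b \<Rightarrow> real"
  assumes "\<And>j. ((\<lambda>k. f k j) \<longlongrightarrow> g j) F"
  shows "((\<lambda>k. prod_list (map (f k) js)) \<longlongrightarrow> prod_list (map g js)) F"
  by (induction js) (auto intro: tendsto_mult assms)

text \<open>Each entry is a polynomial in the entries of the vector.\<close>

lemma tendsto_tensor_apply:
  assumes "(u \<longlongrightarrow> x) F"
  shows "((\<lambda>k. tensor_apply m A (u k)) \<longlongrightarrow> tensor_apply m A x) F"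
proof (rule vec_tendstoI)
  fix i
  show "((\<lambda>k. tensor_apply m A (u k) $ i) \<longlongrightarrow> tensor_apply m A x $ i) F"
    unfolding tensor_apply_nth
    by (intro tendsto_sum tendsto_mult tendsto_const tendsto_prod_list_map tendsto_vec_nth assms)
qed

lemma antimono_nonneg_vec_convergent:
  fixes u :: "nat \<Rightarrow> real ^ 'n"
  assumes "antimono u" and "\<And>k. 0 \<le> u k"
  obtains x where "u \<longlonglongrightarrow> x"
proof -
  have "\<exists>l. (\<lambda>k. u k $ i) \<longlonglongrightarrow> l" for i
  proof -
    have "decseq (\<lambda>k. u k $ i)"
      using antimonoD[OF assms(1)] by (auto simp: monotone_on_def less_eq_vec_def)
    moreover have "\<forall>k. 0 \<le> u k $ i"
      using assms(2) by (auto simp: less_eq_vec_def)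
    ultimately show ?thesis
      using decseq_convergent by blast
  qed
  then obtain l where "\<And>i. (\<lambda>k. u k $ i) \<longlonglongrightarrow> l i" by metis
  then have "u \<longlonglongrightarrow> (\<chi> i. l i)"
    by (intro vec_tendstoI) simp
  then show thesis by (rule that)
qed

lemma vec_tendsto_bounds:
  fixes u :: "nat \<Rightarrow> real ^ 'n"
  assumes "u \<longlonglongrightarrow> x"
  shows "(\<And>k. a \<le> u k) \<Longrightarrow> a \<le> x" and "antimono u \<Longrightarrow> x \<le> u k"
proof -
  have lim: "(\<lambda>k. u k $ i) \<longlonglongrightarrow> x $ i" for i
    by (rule tendsto_vec_nth[OF assms])
  show "a \<le> x" if "\<And>k. a \<le> u k"
    unfolding less_eq_vec_def using that
    by (auto intro!: LIMSEQ_le_const[OF lim] simp: less_eq_vec_def)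
  show "x \<le> u k" if "antimono u"
    unfolding less_eq_vec_def
  proof
    fix i
    show "x $ i \<le> u k $ i"
      using antimonoD[OF that]
      by (intro decseq_ge[OF _ lim]) (auto simp: monotone_on_def less_eq_vec_def)
  qed
qed

theorem corollary8:
  fixes m :: nat
    and A :: "'n::finite tensor"
    and b :: "real ^ 'n"
    and bs xs :: "nat \<Rightarrow> real ^ 'n"
  assumes "2 \<le> m"
    and "nonsingular_M_tensor m A"
    and "0 \<le> b"
    and "\<And>k. 1 \<le> k \<Longrightarrow> positive_vec (bs k)"
    and "antimono_on {1..} bs"
    and "bs \<longlonglongrightarrow> b"
    and "\<And>k. 1 \<le> k \<Longrightarrow> unique_positive_solution m A (bs k) (xs k)"
  shows "maximal_nonneg_solution m A b (x_max m A b) \<and> xs \<longlonglongrightarrow> x_max m A b"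
proof -
  \<comment> \<open>The hypotheses speak of indices from 1 on; the shift makes them hold for every k
    and does not affect limits.\<close>
  define c where "c k = bs (Suc k)" for k
  define u where "u k = xs (Suc k)" for k
  have upos: "positive_vec (u k)" and Au: "tensor_apply m A (u k) = c k" for k
    using assms(7)[of "Suc k"] by (auto simp: unique_positive_solution_def c_def u_def)
  have cpos: "positive_vec (c k)" for k
    by (simp add: c_def assms(4))
  have c_antimono: "antimono c"
    using assms(5) by (auto simp: monotone_on_def c_def)
  have c_lim: "c \<longlonglongrightarrow> b"
    unfolding c_def by (rule LIMSEQ_Suc[OF assms(6)])
  \<comment> \<open>Serves twice: with a later \<open>u\<close> as \<open>y\<close> it gives
    monotonicity, and with an arbitrary nonnegative solution for \<open>b\<close> it gives
    maximality.\<close>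
  have u_ge: "y \<le> u k" if "0 \<le> y" and "tensor_apply m A y \<le> c k" for y k
    using nonsingular_M_tensor_comparison[OF assms(1,2) upos _ \<open>0 \<le> y\<close>] cpos that(2)
    by (simp add: Au)
  have u_nonneg: "0 \<le> u k" for k
    using upos[of k] by (auto simp: positive_vec_def less_eq_vec_def intro: less_imp_le)
  have u_antimono: "antimono u"
    using c_antimono by (auto simp: antimono_def Au intro!: u_ge u_nonneg)
  obtain x where u_lim: "u \<longlonglongrightarrow> x"
    using antimono_nonneg_vec_convergent[OF u_antimono u_nonneg] .
  have "c \<longlonglongrightarrow> tensor_apply m A x"
    using tendsto_tensor_apply[OF u_lim, of m A] by (simp add: Au)
  then have "tensor_apply m A x = b"
    using c_lim by (rule LIMSEQ_unique)
  moreover have "0 \<le> x"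
    by (rule vec_tendsto_bounds(1)[OF u_lim u_nonneg])
  \<comment> \<open>A decreasing sequence stays above its limit, so \<open>b \<le> c k\<close> and
    \<open>y \<le> u k\<close> for every k; then k tends to infinity.\<close>
  moreover have "y \<le> x" if "0 \<le> y" and "tensor_apply m A y = b" for y
    using that vec_tendsto_bounds(2)[OF c_lim c_antimono]
    by (intro vec_tendsto_bounds(1)[OF u_lim] u_ge) auto
  ultimately have max: "maximal_nonneg_solution m A b x"
    by (simp add: maximal_nonneg_solution_def)
  moreover have "xs \<longlonglongrightarrow> x"
    using u_lim unfolding u_def by (rule LIMSEQ_imp_Suc)
  \<comment> \<open>Having a maximal solution \<open>x\<close> at hand identifies the definite
    description \<open>x_max m A b\<close> with it.\<close>
  ultimately show ?thesis
    by (simp add: x_max_eq)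
qed

end
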